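(* For every integer $n\ge 5$, $\beta_E(J_{n,2}) = \beta_M(J_{n,2}) = \binom{n}{2} - \lfloor n/2 \rfloor$.
   Context: The Johnson graph $J_{n,2}$ has as vertices all $2$-element subsets of $\{1,\dots,n\}$, two of them $A,B$ being adjacent iff $|A\cap B|=1$; the graph distance is $d(A,B)=2-|A\cap B|$. For an edge $e=uv$ and a vertex $w$, $d(e,w)=\min\{d(u,w),d(v,w)\}$. A set $N\subseteq V(G)$ is an edge resolving set of a connected graph $G$ if for every two distinct edges $e_1,e_2$ there is $w\in N$ with $d(e_1,w)\ne d(e_2,w)$; $\beta_E(G)$ is the minimum cardinality of an edge resolving set. A set $M\subseteq V(G)$ is a mixed resolving set if for every two distinct items $a,b\in V(G)\cup E(G)$ there is $w\in M$ with $d(a,w)\ne d(b,w)$; the mixed metric dimension $\beta_M(G)$ is the minimum cardinality of a mixed resolving set. *)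

theory Defs
  imports Main
begin

text \<open>
  A simple graph is a pair \<open>(V, E)\<close> of a vertex set and a set of edges, each edge being a
  two-element set of vertices.
\<close>

type_synonym 'a graph = "'a set \<times> 'a set set"

abbreviation verts :: "'a graph \<Rightarrow> 'a set" where
  "verts G \<equiv> fst G"

abbreviation edges :: "'a graph \<Rightarrow> 'a set set" where
  "edges G \<equiv> snd G"

definition simple_graph :: "'a graph \<Rightarrow> bool" where
  "simple_graph G \<longleftrightarrow> (\<forall>e\<in>edges G. e \<subseteq> verts G \<and> card e = 2)"

definition adj_rel :: "'a graph \<Rightarrow> ('a \<times> 'a) set" where
  "adj_rel G = {(u, v). {u, v} \<in> edges G}"

definition connected_graph :: "'a graph \<Rightarrow> bool" where
  "connected_graph G \<longleftrightarrow> (\<forall>u\<in>verts G. \<forall>v\<in>verts G. (u, v) \<in> (adj_rel G)\<^sup>*)"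

text \<open>
  The relational power \<open>adj_rel G ^^ k\<close> relates the end points of the walks of length \<open>k\<close>.
  The value of \<open>gdist\<close> is meaningful only when some walk joins the two vertices, hence for
  all pairs of vertices of a connected graph.
\<close>

definition gdist :: "'a graph \<Rightarrow> 'a \<Rightarrow> 'a \<Rightarrow> nat" where
  "gdist G u v = (LEAST k. (u, v) \<in> adj_rel G ^^ k)"

definition edge_dist :: "'a graph \<Rightarrow> 'a set \<Rightarrow> 'a \<Rightarrow> nat" where
  "edge_dist G e w = Min ((\<lambda>u. gdist G u w) ` e)"

text \<open>
  The items of \<open>G\<close> are its vertices and edges; the union of the vertex set and the edge set is
  taken as a disjoint sum, since vertices and edges have different types.
\<close>

definition items :: "'a graph \<Rightarrow> ('a + 'a set) set" where
  "items G = verts G <+> edges G"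

fun item_dist :: "'a graph \<Rightarrow> 'a + 'a set \<Rightarrow> 'a \<Rightarrow> nat" where
  "item_dist G (Inl v) w = gdist G v w"
| "item_dist G (Inr e) w = edge_dist G e w"

definition edge_resolving :: "'a graph \<Rightarrow> 'a set \<Rightarrow> bool" where
  "edge_resolving G N \<longleftrightarrow> N \<subseteq> verts G \<and>
     (\<forall>e1\<in>edges G. \<forall>e2\<in>edges G. e1 \<noteq> e2 \<longrightarrow>
        (\<exists>w\<in>N. edge_dist G e1 w \<noteq> edge_dist G e2 w))"

definition mixed_resolving :: "'a graph \<Rightarrow> 'a set \<Rightarrow> bool" where
  "mixed_resolving G M \<longleftrightarrow> M \<subseteq> verts G \<and>
     (\<forall>a\<in>items G. \<forall>b\<in>items G. a \<noteq> b \<longrightarrow>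
        (\<exists>w\<in>M. item_dist G a w \<noteq> item_dist G b w))"

text \<open>
  The condition \<open>finite N\<close> only excludes infinite sets, whose \<open>card\<close> is \<open>0\<close>; it is vacuous for
  finite graphs.
\<close>

definition edge_metric_dim :: "'a graph \<Rightarrow> nat" where
  "edge_metric_dim G = (LEAST k. \<exists>N. finite N \<and> edge_resolving G N \<and> card N = k)"

definition mixed_metric_dim :: "'a graph \<Rightarrow> nat" where
  "mixed_metric_dim G = (LEAST k. \<exists>M. finite M \<and> mixed_resolving G M \<and> card M = k)"

definition johnson2 :: "nat \<Rightarrow> nat set graph" where
  "johnson2 n =
     (let V = {A. A \<subseteq> {1..n} \<and> card A = 2}
      in (V, {{A, B} | A B. A \<in> V \<and> B \<in> V \<and> card (A \<inter> B) = 1}))"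

lemma verts_johnson2: "verts (johnson2 n) = {A. A \<subseteq> {1..n} \<and> card A = 2}"
  by (simp add: johnson2_def)

lemma adj_rel_johnson2:
  "(A, B) \<in> adj_rel (johnson2 n) \<longleftrightarrow>
     A \<in> verts (johnson2 n) \<and> B \<in> verts (johnson2 n) \<and> card (A \<inter> B) = 1"
  by (auto simp: adj_rel_def johnson2_def Let_def doubleton_eq_iff Int_commute)

lemma simple_graph_johnson2: "simple_graph (johnson2 n)"
  by (auto simp: simple_graph_def johnson2_def Let_def card_insert_if)

lemma walk_johnson2:
  assumes "A \<in> verts (johnson2 n)" and "B \<in> verts (johnson2 n)"
  shows "(A, B) \<in> adj_rel (johnson2 n) ^^ (2 - card (A \<inter> B))"
proof -
  have A: "A \<subseteq> {1..n}" "card A = 2" and B: "B \<subseteq> {1..n}" "card B = 2"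
    using assms by (auto simp: verts_johnson2)
  have fin: "finite A" "finite B"
    using A B by (auto intro: card_ge_0_finite)
  have "card (A \<inter> B) \<le> 2"
    using card_mono[of A "A \<inter> B"] fin A by auto
  then consider "card (A \<inter> B) = 0" | "card (A \<inter> B) = 1" | "card (A \<inter> B) = 2"
    by linarith
  then show ?thesis
  proof cases
    case 1
    then have disj: "A \<inter> B = {}"
      using fin by simp
    obtain a b where ab: "A = {a, b}" "a \<noteq> b"
      using A by (auto simp: card_2_iff)
    obtain c d where cd: "B = {c, d}" "c \<noteq> d"
      using B by (auto simp: card_2_iff)
    have ne: "a \<noteq> c" "a \<noteq> d" "b \<noteq> c" "b \<noteq> d"
      using disj ab cd by auto
    have C: "{a, c} \<in> verts (johnson2 n)"
      using A B ab cd ne by (auto simp: verts_johnson2)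
    have "A \<inter> {a, c} = {a}" "{a, c} \<inter> B = {c}"
      using ab cd ne by auto
    then have "(A, {a, c}) \<in> adj_rel (johnson2 n)" "({a, c}, B) \<in> adj_rel (johnson2 n)"
      using assms C by (simp_all add: adj_rel_johnson2)
    then show ?thesis
      using 1 by (auto simp: numeral_2_eq_2)
  next
    case 2
    then show ?thesis
      using assms by (simp add: adj_rel_johnson2)
  next
    case 3
    then have "A \<inter> B = A" "A \<inter> B = B"
      using card_subset_eq[of A "A \<inter> B"] card_subset_eq[of B "A \<inter> B"] fin A B by auto
    then have "A = B" by blast
    then show ?thesis
      using 3 by simp
  qed
qed

lemma connected_graph_johnson2: "connected_graph (johnson2 n)"
  unfolding connected_graph_def using walk_johnson2 relpow_imp_rtrancl by blast

lemma gdist_johnson2: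
  assumes "A \<in> verts (johnson2 n)" and "B \<in> verts (johnson2 n)"
  shows "gdist (johnson2 n) A B = 2 - card (A \<inter> B)"
  unfolding gdist_def
proof (rule Least_equality)
  show "(A, B) \<in> adj_rel (johnson2 n) ^^ (2 - card (A \<inter> B))"
    using assms by (rule walk_johnson2)
next
  fix k
  assume k: "(A, B) \<in> adj_rel (johnson2 n) ^^ k"
  have "card A = 2"
    using assms by (simp add: verts_johnson2)
  consider "k = 0" | "k = 1" | "k \<ge> 2"
    by linarith
  then show "2 - card (A \<inter> B) \<le> k"
  proof cases
    case 1
    then show ?thesis
      using k \<open>card A = 2\<close> by simp
  next
    case 2
    then show ?thesis
      using k by (simp add: adj_rel_johnson2)
  qed simp
qed

end

theory Submission
  imports Defs
begin

text \<open>
  The edges \<open>{xa, xb}\<close> and \<open>{xa, ab}\<close> of a triangle of \<open>J\<^bsub>n,2\<^esub>\<close> are resolved by \<open>xb\<close> and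
  \<open>ab\<close> only. Hence two vertices outside an edge resolving set are disjoint, and there are at
  most \<open>\<lfloor>n/2\<rfloor>\<close> of them.

  Conversely let \<open>N\<close> be the complement of a set of pairwise disjoint pairs, and regard an item as
  the set \<open>S\<close> of its one or two vertices. If \<open>N\<close> contains an element of exactly one of two items \<open>S\<close>,
  \<open>T\<close>, this element resolves them. Otherwise some omitted pair \<open>Q\<close> lies in \<open>S\<close>, say, and not in
  \<open>T\<close>. Then a point \<open>b \<in> Q\<close> outside \<open>\<Union>T\<close> and a point \<open>d\<close> outside the at most four points of
  \<open>Q \<union> \<Union>T\<close> give a pair \<open>bd \<in> N\<close> at distance 1 from \<open>S\<close> and 2 from \<open>T\<close>.
\<close>

section \<open>Adjacency and distances in the Johnson graph\<close>

lemma vert_johnson2D: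
  assumes "A \<in> verts (johnson2 n)"
  shows "A \<subseteq> {1..n}" "card A = 2" "finite A"
  using assms finite_subset[of A "{1..n}"] by (auto simp: verts_johnson2)

lemma card_pair_Int:
  assumes "card A = 2" "card B = 2"
  shows "card (A \<inter> B) = (if A = B then 2 else if A \<inter> B = {} then 0 else 1)"
  using assms by (auto simp: card_2_iff doubleton_eq_iff Int_insert_left)

lemma edges_johnson2_iff:
  "{A, B} \<in> edges (johnson2 n) \<longleftrightarrow>
     A \<in> verts (johnson2 n) \<and> B \<in> verts (johnson2 n) \<and> A \<noteq> B \<and> A \<inter> B \<noteq> {}"
  using adj_rel_johnson2[of A B n]
  by (auto simp: adj_rel_def verts_johnson2 card_pair_Int split: if_splits)

lemma edges_johnson2E:
  assumes "e \<in> edges (johnson2 n)"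
  obtains A B where "e = {A, B}" "A \<in> verts (johnson2 n)" "B \<in> verts (johnson2 n)"
    "A \<noteq> B" "A \<inter> B \<noteq> {}"
proof -
  from assms obtain A B where "e = {A, B}"
    by (auto simp: johnson2_def Let_def)
  with assms that show thesis
    by (auto simp: edges_johnson2_iff)
qed

text \<open>Two pairs are at distance 0, 1 or 2 according as they are equal, meet in one point or
  are disjoint. Allowing any nonempty \<open>S\<close> treats edges and, as singletons, vertices
  alike.\<close>

lemma edge_dist_johnson2:
  assumes "S \<subseteq> verts (johnson2 n)" "finite S" "S \<noteq> {}" "w \<in> verts (johnson2 n)"
  shows "edge_dist (johnson2 n) S w =
    (if w \<in> S then 0 else if w \<inter> \<Union>S = {} then 2 else 1)"
proof -
  have gd: "gdist (johnson2 n) u w = (if u = w then 0 else if u \<inter> w = {} then 2 else 1)"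
    if "u \<in> S" for u
  proof -
    have "u \<in> verts (johnson2 n)" using that assms by blast
    then show ?thesis
      using assms(4) card_pair_Int[of u w] by (simp add: gdist_johnson2 verts_johnson2)
  qed
  show ?thesis
    unfolding edge_dist_def
  proof (rule Min_eqI)
    show "finite ((\<lambda>u. gdist (johnson2 n) u w) ` S)"
      using assms by simp
    show "(if w \<in> S then 0 else if w \<inter> \<Union>S = {} then 2 else 1) \<le> y"
      if "y \<in> (\<lambda>u. gdist (johnson2 n) u w) ` S" for y
      using that by (auto simp: gd split: if_splits)
    \<comment> \<open>A closest member: \<open>w\<close> itself if it lies in \<open>S\<close>,
      otherwise one meeting \<open>w\<close> if possible, otherwise any.\<close>
    obtain u where u: "u \<in> S" "w \<in> S \<Longrightarrow> u = w" "w \<inter> \<Union>S \<noteq> {} \<Longrightarrow> w \<notin> S \<Longrightarrow> u \<inter> w \<noteq> {}"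
      using assms(3) by blast
    have "u \<inter> w = {}" if "w \<inter> \<Union>S = {}"
      using that u(1) by blast
    with u have "(if w \<in> S then 0 else if w \<inter> \<Union>S = {} then 2 else 1) = gdist (johnson2 n) u w"
      by (simp add: gd) blast
    with u(1) show "(if w \<in> S then 0 else if w \<inter> \<Union>S = {} then 2 else 1)
        \<in> (\<lambda>u. gdist (johnson2 n) u w) ` S"
      by (rule rev_image_eqI)
  qed
qed

section \<open>Lower bound: omitted pairs form a matching\<close>

lemma edge_resolving_johnson2_complement_disjoint:
  assumes N: "edge_resolving (johnson2 n) N"
    and P: "P \<in> verts (johnson2 n) - N" and Q: "Q \<in> verts (johnson2 n) - N" and "P \<noteq> Q"
  shows "P \<inter> Q = {}"
proof (rule ccontr)
  assume "P \<inter> Q \<noteq> {}"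
  then obtain b where b: "b \<in> P" "b \<in> Q" by blast
  obtain x where x: "P = {x, b}" "x \<noteq> b"
    using P b by (auto simp: verts_johnson2 card_2_iff)
  obtain a where a: "Q = {a, b}" "a \<noteq> b"
    using Q b by (auto simp: verts_johnson2 card_2_iff)
  have "a \<noteq> x" using x a \<open>P \<noteq> Q\<close> by blast
  let ?R = "{x, a}"
  have R: "?R \<in> verts (johnson2 n)"
    using P Q x a \<open>a \<noteq> x\<close> by (auto simp: verts_johnson2)
  have ne: "?R \<noteq> P" "?R \<noteq> Q"
    using x a \<open>a \<noteq> x\<close> by (auto simp: doubleton_eq_iff)
  have "{?R, P} \<in> edges (johnson2 n)" "{?R, Q} \<in> edges (johnson2 n)"
    unfolding edges_johnson2_iff using P Q R ne x a by auto
  moreover have "{?R, P} \<noteq> {?R, Q}"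
    using \<open>P \<noteq> Q\<close> by (auto simp: doubleton_eq_iff)
  ultimately have
    "\<exists>w\<in>N. edge_dist (johnson2 n) {?R, P} w \<noteq> edge_dist (johnson2 n) {?R, Q} w"
    using N by (simp add: edge_resolving_def)
  then obtain w where w: "w \<in> N"
    "edge_dist (johnson2 n) {?R, P} w \<noteq> edge_dist (johnson2 n) {?R, Q} w"
    by blast
  have wV: "w \<in> verts (johnson2 n)" using N w by (auto simp: edge_resolving_def)
  \<comment> \<open>Both edges cover exactly the points \<open>x\<close>, \<open>a\<close>,
    \<open>b\<close>, so only membership of \<open>w\<close> could tell them apart; that would force
    \<open>w\<close> to be \<open>P\<close> or \<open>Q\<close>, which are outside
    \<open>N\<close>.\<close>
  have U: "\<Union>{?R, P} = \<Union>{?R, Q}" using x a by auto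
  have "w \<in> {?R, P} \<longleftrightarrow> w \<in> {?R, Q}" using w P Q by auto
  then have "edge_dist (johnson2 n) {?R, P} w = edge_dist (johnson2 n) {?R, Q} w"
    using P Q R wV U edge_dist_johnson2[of "{?R, P}" n w] edge_dist_johnson2[of "{?R, Q}" n w]
    by simp
  with w show False by simp
qed

text \<open>Disjoint pairs cover exactly \<open>2 * card M\<close> points of
  \<open>X\<close>.\<close>

lemma card_pairwise_disjoint_pairs_le:
  assumes "M \<subseteq> {A. A \<subseteq> X \<and> card A = 2}" "pairwise disjnt M" "finite X"
  shows "card M \<le> card X div 2"
proof -
  have "card (\<Union>M) = (\<Sum>A\<in>M. card A)"
  proof (rule card_Union_disjoint)
    show "finite A" if "A \<in> M" for A
      using that assms finite_subset by blast
  qed (fact assms)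
  also have "\<dots> = 2 * card M"
    using assms(1) sum_bounded_above[of M card 2] sum_bounded_below[of M 2 card]
    by (intro order_antisym) (auto simp: subset_eq mult.commute)
  finally have "2 * card M = card (\<Union>M)" ..
  also have "\<dots> \<le> card X"
    using assms by (intro card_mono Union_least) blast+
  finally show ?thesis by simp
qed

lemma finite_verts_johnson2: "finite (verts (johnson2 n))"
  by (simp add: verts_johnson2)

lemma card_verts_johnson2: "card (verts (johnson2 n)) = n choose 2"
  using n_subsets[of "{1..n}" 2] by (simp add: verts_johnson2)

lemma edge_resolving_johnson2_card_ge:
  assumes N: "edge_resolving (johnson2 n) N"
  shows "(n choose 2) - n div 2 \<le> card N"
proof -
  let ?M = "verts (johnson2 n) - N"
  have "N \<subseteq> verts (johnson2 n)" using N by (simp add: edge_resolving_def)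
  then have "card ?M = (n choose 2) - card N"
    using finite_verts_johnson2 by (simp add: card_Diff_subset finite_subset card_verts_johnson2)
  moreover have "card ?M \<le> card {1..n} div 2"
  proof (rule card_pairwise_disjoint_pairs_le)
    show "pairwise disjnt ?M"
      using edge_resolving_johnson2_complement_disjoint[OF N]
      by (auto simp: pairwise_def disjnt_def)
  qed (auto simp: verts_johnson2)
  ultimately show ?thesis by simp
qed

section \<open>Upper bound: complements of matchings resolve all items\<close>

text \<open>Such a \<open>w\<close> is at distance 1 from \<open>S\<close>, since it meets
  \<open>Q\<close> without belonging to \<open>S\<close>, and at distance 2 from \<open>T\<close>.
  The set \<open>insert {A} (edges (johnson2 n))\<close> admits a vertex, as the singleton
  \<open>{A}\<close>, besides all edges; for an edge, \<open>A\<close> is an arbitrary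
  vertex.\<close>

lemma johnson2_separating_pair:
  assumes n: "n \<ge> 5" and M: "pairwise disjnt M"
    and S: "S \<in> insert {A} (edges (johnson2 n))" "A \<in> verts (johnson2 n)"
    and T: "T \<in> insert {B} (edges (johnson2 n))" "B \<in> verts (johnson2 n)"
    and ST: "S - M = T - M" and Q: "Q \<in> S - T"
  obtains w where "w \<in> verts (johnson2 n) - M" "w \<notin> S" "w \<inter> Q \<noteq> {}" "w \<inter> \<Union>T = {}"
proof -
  have QM: "Q \<in> M" using Q ST by blast
  have TV: "T \<subseteq> verts (johnson2 n)"
    using T by (auto elim: edges_johnson2E)
  have QV: "Q \<in> verts (johnson2 n)"
    using S Q by (auto elim: edges_johnson2E)
  note Q2 = vert_johnson2D[OF QV]
  have disj: "R \<inter> Q = {}" if "R \<in> T" "R \<in> M" for R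
    using pairwiseD[OF M \<open>R \<in> M\<close> QM] that Q by (auto simp: disjnt_def)
  have finU: "finite (\<Union>T)"
    using TV by (intro finite_subset[of "\<Union>T" "{1..n}"]) (auto simp: verts_johnson2)
  have "(\<exists>b\<in>Q. b \<notin> \<Union>T) \<and> card (Q \<union> \<Union>T) \<le> 4"
  proof (cases "T - M = {}")
    case True
    \<comment> \<open>The ends of an edge meet, so they cannot both lie in the matching
      \<open>M\<close>.\<close>
    have "\<exists>R. T = {R}"
    proof (cases "T = {B}")
      case False
      then have "T \<in> edges (johnson2 n)" using T by blast
      then obtain C D where "T = {C, D}" "C \<noteq> D" "C \<inter> D \<noteq> {}" by (rule edges_johnson2E)
      then show ?thesis using True M by (auto simp: pairwise_def disjnt_def)
    qed blast
    then obtain R where R: "T = {R}" by blast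
    then have "R \<inter> Q = {}" using True disj by blast
    moreover have "card R = 2" using TV R by (auto simp: verts_johnson2)
    moreover have "Q \<noteq> {}" using Q2 by auto
    ultimately show ?thesis
      using R Q2 card_Un_le[of Q R] by auto
  next
    case False
    \<comment> \<open>Now \<open>S\<close> and \<open>T\<close> share a vertex \<open>P\<close>
      outside \<open>M\<close>, so \<open>S\<close> is the edge \<open>{P, Q}\<close> and
      \<open>b\<close> is the point of \<open>Q\<close> not in \<open>P\<close>.\<close>
    then obtain P where P: "P \<in> T" "P \<notin> M" "P \<in> S" using ST by blast
    have "S \<noteq> {A}" using P Q by auto
    then have "S \<in> edges (johnson2 n)" using S by blast
    then obtain C D where "S = {C, D}" "C \<noteq> D" "C \<inter> D \<noteq> {}" by (rule edges_johnson2E)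
    with P Q have SPQ: "S = {P, Q}" "P \<noteq> Q" "P \<inter> Q \<noteq> {}"
      by (auto simp: Int_commute)
    have P2: "card P = 2" "finite P"
      using TV P vert_johnson2D by blast+
    have PQ1: "card (Q \<inter> P) = 1"
      using card_pair_Int[of Q P] Q2 P2 SPQ by auto
    then have QP: "card (Q - P) = 1"
      using Q2 P2 by (simp add: card_Diff_subset_Int)
    then obtain b where b: "b \<in> Q" "b \<notin> P"
      by (metis Diff_iff card_1_singletonE singletonI)
    \<comment> \<open>A member of \<open>T\<close> in \<open>M\<close> is disjoint from
      \<open>Q\<close>; any other lies in \<open>S - M\<close>, hence is \<open>P\<close>.\<close>
    have "b \<notin> R" if "R \<in> T" for R
      using that b disj[of R] ST SPQ QM by blast
    moreover have "card (\<Union>T) \<le> 3"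
    proof (cases "T = {B}")
      case True
      then show ?thesis using T by (auto simp: verts_johnson2)
    next
      case False
      then have "T \<in> edges (johnson2 n)" using T by blast
      then obtain C D where CD: "T = {C, D}" "C \<in> verts (johnson2 n)" "D \<in> verts (johnson2 n)"
        "C \<noteq> D" "C \<inter> D \<noteq> {}" by (rule edges_johnson2E)
      then have "finite C" "finite D" "card C = 2" "card D = 2"
        by (simp_all add: vert_johnson2D)
      moreover have "card (C \<inter> D) = 1"
        using calculation card_pair_Int[of C D] CD by auto
      ultimately show ?thesis
        using card_Un_Int[of C D] CD by auto
    qed
    \<comment> \<open>As \<open>P\<close> is in \<open>T\<close>, \<open>Q\<close> adds at most one
      point to the at most three of \<open>\<Union>T\<close>. Counting both points of
      \<open>Q\<close> would give only the bound 5, too weak for \<open>n = 5\<close>.\<close>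
    moreover have "Q \<union> \<Union>T = (Q - P) \<union> \<Union>T" using P by blast
    ultimately show ?thesis
      using b QP card_Un_le[of "Q - P" "\<Union>T"] by auto
  qed
  then obtain b where b: "b \<in> Q" "b \<notin> \<Union>T" and c4: "card (Q \<union> \<Union>T) \<le> 4" by blast
  have "\<not> {1..n} \<subseteq> Q \<union> \<Union>T"
    using card_mono[of "Q \<union> \<Union>T" "{1..n}"] Q2 finU c4 n by auto
  then obtain d where d: "d \<in> {1..n}" "d \<notin> Q" "d \<notin> \<Union>T"
    unfolding subset_iff Un_iff by metis
  have "b \<noteq> d" using b d by blast
  then have wV: "{b, d} \<in> verts (johnson2 n)"
    using b d Q2 by (auto simp: verts_johnson2)
  have wM: "{b, d} \<notin> M"
  proof
    assume "{b, d} \<in> M"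
    moreover have "{b, d} \<noteq> Q" using d by blast
    ultimately have "disjnt {b, d} Q" using pairwiseD[OF M _ QM] by blast
    then show False using b by (simp add: disjnt_def)
  qed
  show thesis
  proof
    show "{b, d} \<in> verts (johnson2 n) - M" using wV wM by blast
    \<comment> \<open>Being outside \<open>M\<close>, the pair would also lie in \<open>T\<close>,
      but \<open>b\<close> is not covered by \<open>T\<close>.\<close>
    show "{b, d} \<notin> S"
      using wM ST b by blast
    show "{b, d} \<inter> Q \<noteq> {}" using b by blast
    show "{b, d} \<inter> \<Union>T = {}" using b d by blast
  qed
qed

lemma mixed_resolving_johnson2_Diff:
  assumes n: "n \<ge> 5" and M: "pairwise disjnt M"
  shows "mixed_resolving (johnson2 n) (verts (johnson2 n) - M)"
proof -
  let ?G = "johnson2 n"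
  define is_item where
    "is_item S \<longleftrightarrow> (\<exists>A\<in>verts ?G. S = {A}) \<or> S \<in> edges ?G" for S
  have item: "S \<subseteq> verts ?G" "finite S" "S \<noteq> {}" if "is_item S" for S
    using that unfolding is_item_def by (auto elim: edges_johnson2E)
  have half: "\<exists>w\<in>verts ?G - M. edge_dist ?G S w \<noteq> edge_dist ?G T w"
    if S: "is_item S" and T: "is_item T" and Q: "Q \<in> S - T" for S T Q
  proof (cases "S - M = T - M")
    case False
    \<comment> \<open>This \<open>w\<close> is at distance 0 from exactly one of \<open>S\<close>
      and \<open>T\<close>.\<close>
    then obtain w where w: "w \<notin> M" "w \<in> S \<longleftrightarrow> w \<notin> T" by blast
    then have wV: "w \<in> verts ?G" using item S T by blast
    then have "edge_dist ?G S w \<noteq> edge_dist ?G T w"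
      using w S T by (auto simp: edge_dist_johnson2 item)
    with w wV show ?thesis by blast
  next
    case True
    have V: "Q \<in> verts ?G" using Q item S by blast
    obtain A where A: "S \<in> insert {A} (edges ?G)" "A \<in> verts ?G"
      using S V unfolding is_item_def by blast
    obtain B where B: "T \<in> insert {B} (edges ?G)" "B \<in> verts ?G"
      using T V unfolding is_item_def by blast
    obtain w where w: "w \<in> verts ?G - M" "w \<notin> S" "w \<inter> Q \<noteq> {}" "w \<inter> \<Union>T = {}"
      using johnson2_separating_pair[OF n M A B True Q] by blast
    have "w \<inter> \<Union>S \<noteq> {}" using w Q by blast
    then have "edge_dist ?G S w = 1"
      using w S by (simp add: edge_dist_johnson2 item)
    moreover have "w \<notin> T" using w True by blast
    then have "edge_dist ?G T w = 2"
      using w T by (simp add: edge_dist_johnson2 item)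
    ultimately show ?thesis using w by force
  qed
  have full: "\<exists>w\<in>verts ?G - M. edge_dist ?G S w \<noteq> edge_dist ?G T w"
    if "is_item S" "is_item T" "S \<noteq> T" for S T
  proof -
    from \<open>S \<noteq> T\<close> consider Q where "Q \<in> S - T" | Q where "Q \<in> T - S" by blast
    then show ?thesis
    proof cases
      case 1
      from half[OF that(1,2) this] show ?thesis .
    next
      case 2
      from half[OF that(2,1) this] show ?thesis by metis
    qed
  qed
  define vs where "vs = case_sum (\<lambda>v. {v}) (\<lambda>e::nat set set. e)"
  have vs_dist: "item_dist ?G a w = edge_dist ?G (vs a) w" for a w
    by (cases a) (simp_all add: vs_def edge_dist_def)
  have vs_item: "is_item (vs a)" if "a \<in> items ?G" for a
    using that
    by (cases a) (simp_all add: vs_def items_def Plus_def image_iff is_item_def)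
  \<comment> \<open>An edge has two vertices, so it is never the singleton of a vertex: passing from
    items to vertex sets keeps distinct items distinct.\<close>
  have single: "e \<noteq> {v}" if "e \<in> edges ?G" for e v
    using simple_graph_johnson2[of n] that by (auto simp: simple_graph_def)
  have vs_inj: "vs a \<noteq> vs b" if "a \<in> items ?G" "b \<in> items ?G" "a \<noteq> b" for a b
    using that single single[symmetric]
    by (cases a; cases b) (simp_all add: vs_def items_def Plus_def image_iff)
  show ?thesis
    unfolding mixed_resolving_def vs_dist
    using full[OF vs_item vs_item vs_inj] by simp
qed

text \<open>Edges are items. This carries the lower bound over to mixed resolving sets and lets one
  construction serve both dimensions.\<close>

lemma edge_resolving_if_mixed_resolving:
  assumes "mixed_resolving G M"
  shows "edge_resolving G M"
proof -
  have "\<exists>w\<in>M. item_dist G a w \<noteq> item_dist G b w"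
    if "a \<in> items G" "b \<in> items G" "a \<noteq> b" for a b
    using assms that by (simp add: mixed_resolving_def)
  from this[of "Inr _" "Inr _"] show ?thesis
    using assms by (simp add: edge_resolving_def mixed_resolving_def items_def InrI)
qed

lemma ex_pairwise_disjoint_pairs:
  obtains M where "M \<subseteq> verts (johnson2 n)" "pairwise disjnt M" "card M = n div 2"
proof -
  \<comment> \<open>The matching {1,2}, {3,4}, ...; the index starts at 0, and
    \<open>i < n div 2\<close> ensures \<open>2 * i + 2 \<le> n\<close>.\<close>
  define f :: "nat \<Rightarrow> nat set" where "f i = {2 * i + 1, 2 * i + 2}" for i
  have disj: "f i \<inter> f j = {}" if "i \<noteq> j" for i j
    using that unfolding f_def by (auto; presburger)
  have "f i \<noteq> {}" for i by (simp add: f_def)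
  then have "inj f" using disj by (metis inf.idem injI)
  show thesis
  proof
    show "f ` {..<n div 2} \<subseteq> verts (johnson2 n)"
      by (auto simp: verts_johnson2 f_def)
    show "pairwise disjnt (f ` {..<n div 2})"
      unfolding pairwise_image using disj by (simp add: pairwise_def disjnt_def)
    show "card (f ` {..<n div 2}) = n div 2"
      using \<open>inj f\<close> by (simp add: card_image inj_on_subset)
  qed
qed

theorem theorem4:
  fixes n :: nat
  assumes "n \<ge> 5"
  shows "edge_metric_dim (johnson2 n) = (n choose 2) - n div 2 \<and>
         mixed_metric_dim (johnson2 n) = (n choose 2) - n div 2"
proof -
  obtain M where M: "M \<subseteq> verts (johnson2 n)" "pairwise disjnt M" "card M = n div 2"
    by (rule ex_pairwise_disjoint_pairs)
  define N where "N = verts (johnson2 n) - M"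
  have N: "finite N" "card N = (n choose 2) - n div 2"
    using M finite_verts_johnson2
    by (simp_all add: N_def card_Diff_subset finite_subset card_verts_johnson2)
  have mixed: "mixed_resolving (johnson2 n) N"
    unfolding N_def using assms M(2) by (rule mixed_resolving_johnson2_Diff)
  have "edge_metric_dim (johnson2 n) = (n choose 2) - n div 2"
    unfolding edge_metric_dim_def
    using N edge_resolving_if_mixed_resolving[OF mixed] edge_resolving_johnson2_card_ge
    by (intro Least_equality) blast+
  moreover have "mixed_metric_dim (johnson2 n) = (n choose 2) - n div 2"
    unfolding mixed_metric_dim_def
    using N mixed edge_resolving_johnson2_card_ge edge_resolving_if_mixed_resolving
    by (intro Least_equality) blast+
  ultimately show ?thesis ..
qed

end
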